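(* Let $q$ be a prime power and let $2\le n\le m$ be integers. Let $\alpha=q^{n-1}{n\brack 1}$ and $\beta=q^{n-1}\left(q^m+{n-1\brack 1}\right)$. Then $K_R(q^m,n,n-1)$ satisfies $$a\,K_R(q^m,n,n-1)^2-b\,K_R(q^m,n,n-1)+c\ge 0,$$ where $$a=\alpha[v(n-1)+v(n-2)],$$ $$b=v(n-1)\left\{q^{n-2}{n-1\brack 1}-v(1)+\beta+1\right\}+2\alpha q^{mn}+\beta v(n-2),$$ $$c=q^{mn}\left\{2\beta+1+q^{n-2}{n-1\brack 1}-v(1)\right\}.$$
   Context: For $\mathbf{x}\in \mathrm{GF}(q^m)^n$, $\mathrm{rk}(\mathbf{x})$ is the maximum number of coordinates of $\mathbf{x}$ that are linearly independent over $\mathrm{GF}(q)$; the rank distance is $d_R(\mathbf{x},\mathbf{y})=\mathrm{rk}(\mathbf{x}-\mathbf{y})$. $v(r)$ is the number of vectors in a ball of rank radius $r$ in $\mathrm{GF}(q^m)^n$. ${k\brack 1}=\frac{q^k-1}{q-1}$. The rank covering radius of a nonempty code $C\subseteq \mathrm{GF}(q^m)^n$ is $\max_{\mathbf{x}}\min_{\mathbf{c}\in C} d_R(\mathbf{x},\mathbf{c})$. $K_R(q^m,n,\rho)$ denotes the minimum number of balls of rank radius $\rho$ needed to cover $\mathrm{GF}(q^m)^n$, i.e. the minimum cardinality of a (not necessarily linear) code $C\subseteq\mathrm{GF}(q^m)^n$ with rank covering radius at most $\rho$. *)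

theory Defs
  imports "HOL-Analysis.Finite_Cartesian_Product"
begin

text \<open>
  A field extension \<open>GF(q) \<subseteq> GF(q^m)\<close> is given by a unital ring homomorphism \<open>emb\<close> between two
  finite field types \<open>'k\<close> and \<open>'f\<close>, with \<open>q = CARD('k)\<close> and \<open>q^m = CARD('f)\<close>. Vectors of length
  \<open>n\<close> over \<open>GF(q^m)\<close> are elements of \<open>'f ^ 'n\<close> with \<open>n = CARD('n)\<close>.
\<close>

locale finite_field_extension =
  fixes emb :: "'k::{field,finite} \<Rightarrow> 'f::{field,finite}"
  assumes emb_add: "emb (x + y) = emb x + emb y"
    and emb_mult: "emb (x * y) = emb x * emb y"
    and emb_one: "emb 1 = 1"

definition ext_scale :: "('k::{field,finite} \<Rightarrow> 'f::{field,finite}) \<Rightarrow> 'k \<Rightarrow> 'f \<Rightarrow> 'f" where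
  "ext_scale emb c x = emb c * x"

sublocale finite_field_extension \<subseteq> vector_space "ext_scale emb"
  by unfold_locales (simp_all add: ext_scale_def emb_add emb_mult emb_one algebra_simps)

text \<open>
  The injectivity condition makes this linear independence of the family of coordinates indexed
  by \<open>I\<close>: equal coordinates at two different positions are dependent.
\<close>

definition rank_weight ::
    "('k::{field,finite} \<Rightarrow> 'f::{field,finite}) \<Rightarrow> 'f ^ 'n \<Rightarrow> nat" where
  "rank_weight emb x =
     Max {card I | I. inj_on (\<lambda>i. x $ i) I \<and> \<not> module.dependent (ext_scale emb) ((\<lambda>i. x $ i) ` I)}"

definition rank_dist ::
    "('k::{field,finite} \<Rightarrow> 'f::{field,finite}) \<Rightarrow> 'f ^ 'n \<Rightarrow> 'f ^ 'n \<Rightarrow> nat" where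
  "rank_dist emb x y = rank_weight emb (x - y)"

definition rank_ball ::
    "('k::{field,finite} \<Rightarrow> 'f::{field,finite}) \<Rightarrow> 'f ^ 'n \<Rightarrow> nat \<Rightarrow> ('f ^ 'n) set" where
  "rank_ball emb x r = {y. rank_dist emb y x \<le> r}"

text \<open>The volume is taken at the centre \<open>0\<close>; by the lemma below, the centre is irrelevant.\<close>

definition rank_ball_volume ::
    "('k::{field,finite} \<Rightarrow> 'f::{field,finite}) \<Rightarrow> 'n::finite itself \<Rightarrow> nat \<Rightarrow> nat" where
  "rank_ball_volume emb _ r = card (rank_ball emb (0 :: 'f ^ 'n) r)"

lemma card_rank_ball:
  "card (rank_ball emb (x :: 'f::{field,finite} ^ 'n) r) = rank_ball_volume emb TYPE('n) r"
proof -
  have "bij_betw (\<lambda>y. y - x) (rank_ball emb x r) (rank_ball emb 0 r)"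
    by (rule bij_betw_byWitness[where f' = "\<lambda>y. y + x"])
      (auto simp: rank_ball_def rank_dist_def)
  then show ?thesis
    unfolding rank_ball_volume_def by (rule bij_betw_same_card)
qed

definition rank_covering_radius ::
    "('k::{field,finite} \<Rightarrow> 'f::{field,finite}) \<Rightarrow> ('f ^ 'n) set \<Rightarrow> nat" where
  "rank_covering_radius emb C = Max (range (\<lambda>x. Min ((\<lambda>c. rank_dist emb x c) ` C)))"

text \<open>
  The minimum ranges over a finite nonempty set: there are finitely many codes, and the whole
  space has covering radius \<open>0\<close>.
\<close>

definition min_rank_covering_size ::
    "('k::{field,finite} \<Rightarrow> 'f::{field,finite}) \<Rightarrow> 'n::finite itself \<Rightarrow> nat \<Rightarrow> nat" where
  "min_rank_covering_size emb _ \<rho> =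
     Min (card ` {C :: ('f ^ 'n) set. C \<noteq> {} \<and> rank_covering_radius emb C \<le> \<rho>})"

definition gauss1 :: "nat \<Rightarrow> nat \<Rightarrow> real" where
  "gauss1 q k = (real q ^ k - 1) / (real q - 1)"

end

theory Submission
  imports Defs
begin

text \<open>
  Excess counting. Let \<open>C\<close> be an optimal code, \<open>K = card C\<close>, and let the excess of a vector be the
  number of balls of radius \<open>n - 1\<close> around codewords containing it, minus one. If \<open>x\<close> has excess \<open>0\<close>
  and lies at distance exactly \<open>n - 1\<close> from \<open>C\<close>, then one codeword is at distance \<open>n - 1\<close> from \<open>x\<close>
  and the other \<open>K - 1\<close> are at distance \<open>n\<close>, so the total excess on the unit ball around \<open>x\<close> is
  exactly \<open>K\<alpha> - \<beta>\<close>. Conversely, a vector with positive excess has at most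
  \<open>\<delta> = v(1) - 1 - q\<^sup>n\<^sup>-\<^sup>2 [n-1 choose 1]\<close> such \<open>x\<close> in its unit ball. Double counting, together with the lower
  bound \<open>2q\<^sup>m\<^sup>n - K(v(n-1) + v(n-2))\<close> for the number of such \<open>x\<close>, gives
  \<open>(K\<alpha> - \<beta>)(2q\<^sup>m\<^sup>n - K(v(n-1) + v(n-2))) \<le> \<delta>(K v(n-1) - q\<^sup>m\<^sup>n)\<close>, which is the claim. If there is no such \<open>x\<close>,
  the step needs \<open>K\<alpha> \<ge> \<beta>\<close>, which follows from \<open>v(n-1) + v(n-2) \<le> [n choose 1] q\<^sup>m\<^sup>n\<^sup>-\<^sup>m\<close>.
  All ranks are handled through the kernel of \<open>u \<mapsto> \<Sum>\<^sub>i u\<^sub>i x\<^sub>i\<close> on \<open>GF(q)\<^sup>n\<close>, which has \<open>q\<^sup>n\<^sup>-\<^sup>r\<close>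
  elements for \<open>x\<close> of rank \<open>r\<close>.
\<close>

section \<open>Fibres of additive maps on finite groups\<close>

lemma card_fiber_additive:
  fixes f :: "'a::{ab_group_add,finite} \<Rightarrow> 'b::ab_group_add"
  assumes add: "\<And>x y. f (x + y) = f x + f y"
  shows "card {x. f x = f a} = card {x. f x = 0}"
proof -
  have diff: "f (x - y) = f x - f y" for x y
    using add[of "x - y" y] by simp
  have "bij_betw (\<lambda>x. x - a) {x. f x = f a} {x. f x = 0}"
    by (rule bij_betw_byWitness[where f' = "\<lambda>x. x + a"]) (auto simp: diff add)
  then show ?thesis
    by (rule bij_betw_same_card)
qed

text \<open>This plays the part of rank-nullity throughout: dimensions are measured by
  cardinalities, so no complements or bases of kernels have to be chosen.\<close>

lemma card_range_times_kernel:
  fixes f :: "'a::{ab_group_add,finite} \<Rightarrow> 'b::ab_group_add"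
  assumes add: "\<And>x y. f (x + y) = f x + f y"
  shows "card (range f) * card {x. f x = 0} = CARD('a)"
proof -
  have "CARD('a) = card (\<Union>b\<in>range f. {x. f x = b})"
    by (rule arg_cong[where f = card]) auto
  also have "\<dots> = (\<Sum>b\<in>range f. card {x. f x = b})"
    by (rule card_UN_disjoint) auto
  also have "\<dots> = (\<Sum>b\<in>range f. card {x. f x = 0})"
    using card_fiber_additive[of f, OF add] by (intro sum.cong) auto
  finally show ?thesis by simp
qed

lemma card_field_ge_2: "2 \<le> CARD('a::{field,finite})"
proof -
  have "card {0, 1::'a} \<le> CARD('a)"
    by (rule card_mono) auto
  then show ?thesis by simp
qed

section \<open>Rank and kernels\<close>

text \<open>For fixed \<open>x\<close> this is the linear map on \<open>'k ^ 'n\<close> whose image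
  is the span of the coordinates of \<open>x\<close> and whose kernel consists of their linear
  relations.\<close>

definition pairing :: "('k::{field,finite} \<Rightarrow> 'f::{field,finite}) \<Rightarrow> 'k ^ 'n \<Rightarrow> 'f ^ 'n \<Rightarrow> 'f" where
  "pairing emb u x = (\<Sum>i\<in>UNIV. emb (u $ i) * x $ i)"

definition dot :: "'k::{field,finite} ^ 'n \<Rightarrow> 'k ^ 'n \<Rightarrow> 'k" where
  "dot u v = (\<Sum>i\<in>UNIV. u $ i * v $ i)"

text \<open>By \<open>rank_weight_outer_le\<close> and \<open>rank_weight_le_1E\<close> these are
  exactly the vectors of rank at most one.\<close>

definition outer :: "('k::{field,finite} \<Rightarrow> 'f::{field,finite}) \<Rightarrow> 'f \<Rightarrow> 'k ^ 'n \<Rightarrow> 'f ^ 'n" where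
  "outer emb t v = (\<chi> i. t * emb (v $ i))"

lemma dot_add_right: "dot u (v + w) = dot u v + dot u w"
  by (simp add: dot_def distrib_left sum.distrib)

lemma dot_axis_right [simp]: "dot u (axis i a) = u $ i * a"
  by (simp add: dot_def axis_def if_distrib cong: if_cong)

lemma dot_scale_left: "dot (a *s u) v = a * dot u v"
  by (simp add: dot_def sum_distrib_left mult.assoc)

context finite_field_extension
begin

lemma emb_zero [simp]: "emb 0 = 0"
  using emb_add[of 0 0] by (metis add.right_neutral add_left_cancel)

lemma emb_uminus: "emb (- x) = - emb x"
  using emb_add[of x "- x"] by (simp add: eq_neg_iff_add_eq_0 add.commute)

lemma emb_diff: "emb (x - y) = emb x - emb y"
  using emb_add[of x "- y"] by (simp add: emb_uminus)

lemma emb_eq_0_iff [simp]: "emb x = 0 \<longleftrightarrow> x = 0"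
proof
  assume "emb x = 0"
  then show "x = 0"
    using emb_mult[of x "inverse x"] emb_one by (cases "x = 0") auto
qed simp

lemma emb_eq_iff [simp]: "emb x = emb y \<longleftrightarrow> x = y"
  using emb_eq_0_iff[of "x - y"] by (simp add: emb_diff)

lemma emb_sum: "emb (sum f A) = (\<Sum>i\<in>A. emb (f i))"
  by (induction A rule: infinite_finite_induct) (simp_all add: emb_add)

lemma pairing_add_left: "pairing emb (u + v) x = pairing emb u x + pairing emb v x"
  by (simp add: pairing_def emb_add distrib_right sum.distrib)

lemma pairing_add_right: "pairing emb u (x + y) = pairing emb u x + pairing emb u y"
  by (simp add: pairing_def distrib_left sum.distrib)

lemma pairing_scale_left: "pairing emb (a *s u) x = emb a * pairing emb u x"
  by (simp add: pairing_def emb_mult sum_distrib_left mult.assoc)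

lemma pairing_axis_left [simp]: "pairing emb (axis i a) x = emb a * x $ i"
proof -
  have "emb (axis i a $ j) * x $ j = (if j = i then emb a * x $ i else 0)" for j
    by (simp add: axis_def)
  then show ?thesis by (simp add: pairing_def)
qed

lemma pairing_axis_right [simp]: "pairing emb u (axis i a) = emb (u $ i) * a"
  by (simp add: pairing_def axis_def if_distrib cong: if_cong)

lemma pairing_outer: "pairing emb u (outer emb t v) = t * emb (dot u v)"
  by (simp add: pairing_def outer_def dot_def emb_sum emb_mult sum_distrib_left ac_simps)

lemma pairing_zero_left [simp]: "pairing emb 0 x = 0"
  by (simp add: pairing_def)

lemma pairing_zero_right [simp]: "pairing emb u 0 = 0"
  by (simp add: pairing_def)

lemma range_pairing: "range (\<lambda>u. pairing emb u x) = span (range (($) x))"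
proof
  show "range (\<lambda>u. pairing emb u x) \<subseteq> span (range (($) x))"
  proof clarify
    fix u
    have "(\<Sum>i\<in>UNIV. ext_scale emb (u $ i) (x $ i)) \<in> span (range (($) x))"
      by (intro span_sum span_scale span_base) auto
    then show "pairing emb u x \<in> span (range (($) x))"
      by (simp add: pairing_def ext_scale_def)
  qed
  have "range (($) x) \<subseteq> range (\<lambda>u. pairing emb u x)"
  proof clarify
    fix i
    have "x $ i = pairing emb (axis i 1) x"
      by (simp add: emb_one)
    then show "x $ i \<in> range (\<lambda>u. pairing emb u x)" by blast
  qed
  moreover have "subspace (range (\<lambda>u. pairing emb u x))"
  proof (rule subspaceI)
    show "0 \<in> range (\<lambda>u. pairing emb u x)"
      by (rule range_eqI[of _ _ 0]) simp
  next
    fix a b assume "a \<in> range (\<lambda>u. pairing emb u x)" "b \<in> range (\<lambda>u. pairing emb u x)"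
    then show "a + b \<in> range (\<lambda>u. pairing emb u x)"
      by (auto simp: pairing_add_left[symmetric])
  next
    fix c a assume "a \<in> range (\<lambda>u. pairing emb u x)"
    then show "ext_scale emb c a \<in> range (\<lambda>u. pairing emb u x)"
      by (auto simp: ext_scale_def pairing_scale_left[symmetric])
  qed
  ultimately show "span (range (($) x)) \<subseteq> range (\<lambda>u. pairing emb u x)"
    by (rule span_minimal)
qed

text \<open>Induction on the basis: for \<open>a\<close> outside \<open>span B\<close>, each element
  of the larger span is \<open>k\<close> times \<open>a\<close> plus \<open>s\<close> for exactly
  one pair, so a new basis vector multiplies the size by \<open>q\<close>.\<close>

lemma card_span_independent:
  assumes "independent B"
  shows "card (span B) = CARD('k) ^ card B"
proof -
  have "finite B" by simp
  then show ?thesis using assms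
  proof (induction B)
    case empty
    then show ?case by simp
  next
    case (insert a B)
    then have ind: "independent B" and a: "a \<notin> span B"
      by (auto simp: independent_insert)
    have "bij_betw (\<lambda>(k, s). ext_scale emb k a + s) (UNIV \<times> span B) (span (insert a B))"
      unfolding bij_betw_def
    proof
      show "inj_on (\<lambda>(k, s). ext_scale emb k a + s) (UNIV \<times> span B)"
      proof (rule inj_onI, clarify)
        fix k k' :: 'k and s s' :: 'f
        assume s: "s \<in> span B" "s' \<in> span B"
          and eq: "ext_scale emb k a + s = ext_scale emb k' a + s'"
        have "ext_scale emb (k - k') a = s' - s"
          using eq by (simp add: scale_left_diff_distrib algebra_simps)
        then have "ext_scale emb (k - k') a \<in> span B"
          using s by (simp add: span_diff)
        \<comment> \<open>Otherwise scaling by \<open>inverse (k - k')\<close> would bring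
          \<open>a\<close> itself into \<open>span B\<close>.\<close>
        then have "k - k' = 0"
          using a span_scale[of "ext_scale emb (k - k') a" B "inverse (k - k')"]
          by (cases "k = k'") auto
        then show "k = k' \<and> s = s'" using eq by simp
      qed
      show "(\<lambda>(k, s). ext_scale emb k a + s) ` (UNIV \<times> span B) = span (insert a B)"
        unfolding span_insert
      proof safe
        fix k s assume "s \<in> span B"
        then show "\<exists>k'. ext_scale emb k a + s - ext_scale emb k' a \<in> span B"
          by (intro exI[of _ k]) simp
      next
        fix x k assume "x - ext_scale emb k a \<in> span B"
        then show "x \<in> (\<lambda>(k, s). ext_scale emb k a + s) ` (UNIV \<times> span B)"
          by (intro image_eqI[of _ _ "(k, x - ext_scale emb k a)"]) auto
      qed
    qed
    then have "card (span (insert a B)) = card ((UNIV :: 'k set) \<times> span B)"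
      by (simp add: bij_betw_same_card)
    then show ?case
      using insert ind by (simp add: card_cartesian_product)
  qed
qed

text \<open>An independent index set \<open>I\<close> of maximal size spans every coordinate,
  because a coordinate outside the span could be adjoined. So the image of the pairing has a basis
  indexed by \<open>I\<close>.\<close>

lemma card_range_pairing:
  fixes x :: "'f ^ 'n"
  shows "card (range (\<lambda>u. pairing emb u x)) = CARD('k) ^ rank_weight emb x"
    and rank_weight_le: "rank_weight emb x \<le> CARD('n)"
proof -
  let ?P = "\<lambda>I. inj_on (\<lambda>i. x $ i) I \<and> independent ((\<lambda>i. x $ i) ` I)"
  have "{card I | I. ?P I} = card ` {I. ?P I}" by auto
  then have rank: "rank_weight emb x = Max (card ` {I. ?P I})"
    unfolding rank_weight_def by simp
  have "?P {}" by (simp add: independent_empty)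
  then have "card ` {I. ?P I} \<noteq> {}" by blast
  then have "rank_weight emb x \<in> card ` {I. ?P I}"
    unfolding rank by (intro Max_in) auto
  then obtain I where I: "inj_on (\<lambda>i. x $ i) I" "independent ((\<lambda>i. x $ i) ` I)"
    and card_I: "card I = rank_weight emb x"
    by auto
  show "rank_weight emb x \<le> CARD('n)"
    unfolding card_I[symmetric] by (rule card_mono) auto
  have "x $ j \<in> span ((\<lambda>i. x $ i) ` I)" for j
  proof (rule ccontr)
    assume j: "x $ j \<notin> span ((\<lambda>i. x $ i) ` I)"
    then have new: "x $ j \<notin> (\<lambda>i. x $ i) ` I" using span_base by blast
    then have jI: "j \<notin> I" by blast
    have "?P (insert j I)"
      using I new j independent_insertI[OF j I(2)] by auto
    then have "card (insert j I) \<le> rank_weight emb x"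
      unfolding rank by (intro Max_ge) auto
    then show False using card_I jI by simp
  qed
  then have "span (range (($) x)) \<subseteq> span ((\<lambda>i. x $ i) ` I)"
    by (intro span_minimal subspace_span) auto
  moreover have "span ((\<lambda>i. x $ i) ` I) \<subseteq> span (range (($) x))"
    by (rule span_mono) auto
  ultimately have "range (\<lambda>u. pairing emb u x) = span ((\<lambda>i. x $ i) ` I)"
    by (simp add: range_pairing)
  then show "card (range (\<lambda>u. pairing emb u x)) = CARD('k) ^ rank_weight emb x"
    using card_span_independent[OF I(2)] I(1) card_I by (simp add: card_image)
qed

text \<open>Rank-nullity; \<open>rank_weight_le\<close> makes the truncated subtraction in the
  exponent exact.\<close>

lemma card_kernel_pairing:
  fixes x :: "'f ^ 'n"
  shows "card {u. pairing emb u x = 0} = CARD('k) ^ (CARD('n) - rank_weight emb x)"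
proof -
  let ?q = "CARD('k)"
  have "?q ^ rank_weight emb x * card {u. pairing emb u x = 0} = ?q ^ CARD('n)"
    using card_range_times_kernel[of "\<lambda>u. pairing emb u x", OF pairing_add_left]
    by (simp add: card_range_pairing)
  moreover have "?q ^ CARD('n) = ?q ^ rank_weight emb x * ?q ^ (CARD('n) - rank_weight emb x)"
    using rank_weight_le[of x] by (simp flip: power_add)
  ultimately show ?thesis by simp
qed

lemma card_ground_gt_1: "1 < CARD('k)"
  using card_field_ge_2[where 'a = 'k] by simp

lemma rank_weight_le_iff_range:
  "rank_weight emb x \<le> r \<longleftrightarrow> card (range (\<lambda>u. pairing emb u x)) \<le> CARD('k) ^ r"
  using card_ground_gt_1 by (simp add: card_range_pairing power_increasing_iff)

lemma rank_weight_zero [simp]: "rank_weight emb 0 = 0"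
  using rank_weight_le_iff_range[of 0 0] by simp

text \<open>The image for \<open>x + y\<close> lies in the sumset of the two images, which has at
  most as many elements as their product.\<close>

lemma rank_weight_add_le: "rank_weight emb (x + y) \<le> rank_weight emb x + rank_weight emb y"
proof -
  let ?R = "\<lambda>x. range (\<lambda>u. pairing emb u x)"
  have "?R (x + y) \<subseteq> (\<lambda>(a, b). a + b) ` (?R x \<times> ?R y)"
    by (auto simp: pairing_add_right)
  then have "card (?R (x + y)) \<le> card ((\<lambda>(a, b). a + b) ` (?R x \<times> ?R y))"
    by (rule card_mono[rotated]) simp
  also have "\<dots> \<le> card (?R x \<times> ?R y)"
    by (rule card_image_le) simp
  finally show ?thesis
    by (simp add: rank_weight_le_iff_range card_cartesian_product card_range_pairing power_add)
qed

lemma rank_weight_uminus [simp]: "rank_weight emb (- x) = rank_weight emb x"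
proof -
  have "pairing emb u (- x) = pairing emb (- u) x" for u
    by (simp add: pairing_def emb_uminus)
  then have "range (\<lambda>u. pairing emb u (- x)) = range (\<lambda>u. pairing emb u x)"
    by (metis (no_types, lifting) minus_minus rangeE rangeI subsetI subset_antisym)
  then have "CARD('k) ^ rank_weight emb (- x) = CARD('k) ^ rank_weight emb x"
    by (simp flip: card_range_pairing)
  then show ?thesis using card_ground_gt_1 by simp
qed

lemma rank_weight_full_iff:
  fixes x :: "'f ^ 'n"
  shows "rank_weight emb x = CARD('n) \<longleftrightarrow> (\<forall>u. pairing emb u x = 0 \<longrightarrow> u = 0)"
proof -
  have "rank_weight emb x = CARD('n) \<longleftrightarrow> card {u. pairing emb u x = 0} = 1"
    using rank_weight_le[of x] card_ground_gt_1
    by (auto simp: card_kernel_pairing power_eq_1_iff)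
  also have "\<dots> \<longleftrightarrow> {u. pairing emb u x = 0} = {0}"
  proof
    assume "card {u. pairing emb u x = 0} = 1"
    then show "{u. pairing emb u x = 0} = {0}"
      using card_subset_eq[of "{u. pairing emb u x = 0}" "{0}"] by simp
  qed simp
  also have "\<dots> \<longleftrightarrow> (\<forall>u. pairing emb u x = 0 \<longrightarrow> u = 0)"
    using pairing_zero_left[of x] by blast
  finally show ?thesis .
qed

section \<open>Vectors of rank at most one\<close>

lemma outer_nonzero: "t \<noteq> 0 \<Longrightarrow> v \<noteq> 0 \<Longrightarrow> outer emb t v \<noteq> 0"
  by (auto simp: outer_def vec_eq_iff)

lemma rank_weight_outer_le: "rank_weight emb (outer emb t v) \<le> 1"
proof -
  have "range (\<lambda>u. pairing emb u (outer emb t v)) \<subseteq> (\<lambda>k. t * emb k) ` UNIV"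
    by (auto simp: pairing_outer)
  then have "card (range (\<lambda>u. pairing emb u (outer emb t v))) \<le> card ((\<lambda>k. t * emb k) ` UNIV)"
    by (rule card_mono[rotated]) simp
  also have "\<dots> \<le> CARD('k)"
    by (rule card_image_le) simp
  finally show ?thesis by (simp add: rank_weight_le_iff_range)
qed

text \<open>The image of the pairing has at most \<open>q\<close> elements and already contains the
  \<open>q\<close> ground-field multiples of a nonzero coordinate. So every coordinate is such a
  multiple, and that coordinate serves as \<open>t\<close>.\<close>

lemma rank_weight_le_1E:
  assumes "rank_weight emb y \<le> 1" "y \<noteq> 0"
  obtains t v where "t \<noteq> 0" "v \<noteq> 0" "y = outer emb t v"
proof -
  from assms(2) obtain j where j: "y $ j \<noteq> 0"
    by (auto simp: vec_eq_iff)
  let ?R = "range (\<lambda>u. pairing emb u y)"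
  have "(\<lambda>k. emb k * y $ j) ` UNIV = ?R"
  proof (rule card_subset_eq)
    show sub: "(\<lambda>k. emb k * y $ j) ` UNIV \<subseteq> ?R"
    proof clarify
      fix k
      have "emb k * y $ j = pairing emb (axis j k) y" by simp
      then show "emb k * y $ j \<in> ?R" by blast
    qed
    have "card ((\<lambda>k. emb k * y $ j) ` UNIV) = CARD('k)"
      using j by (intro card_image) (auto simp: inj_on_def)
    moreover have "card ?R \<le> CARD('k)"
      using assms(1) by (simp add: rank_weight_le_iff_range)
    ultimately show "card ((\<lambda>k. emb k * y $ j) ` UNIV) = card ?R"
      using card_mono[OF _ sub] by simp
  qed simp
  moreover have "y $ i \<in> ?R" for i
    by (rule range_eqI[of _ _ "axis i 1"]) (simp add: emb_one)
  ultimately have "\<forall>i. \<exists>k. y $ i = emb k * y $ j" by blast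
  then obtain w where w: "\<And>i. y $ i = emb (w i) * y $ j" by metis
  show thesis
  proof
    show "y $ j \<noteq> 0" by (fact j)
    show y: "y = outer emb (y $ j) (\<chi> i. w i)"
    proof -
      have "y $ i = outer emb (y $ j) (\<chi> i. w i) $ i" for i
        using w[of i] by (simp only: outer_def vec_lambda_beta mult.commute)
      then show ?thesis unfolding vec_eq_iff by blast
    qed
    show "(\<chi> i. w i) \<noteq> 0"
    proof
      assume "(\<chi> i. w i) = 0"
      then have "w j = 0" by (metis vec_lambda_beta zero_index)
      then show False using w[of j] j by simp
    qed
  qed
qed

text \<open>The \<open>q - 1\<close> factorisations of a rank-one vector differ by a scalar of the ground field.\<close>

lemma card_outer_fiber:
  assumes "t0 \<noteq> 0" "v0 \<noteq> 0"
  shows "card {(t, v). t \<noteq> 0 \<and> v \<noteq> 0 \<and> outer emb t v = outer emb t0 v0} = CARD('k) - 1"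
proof -
  from assms(2) obtain j where j: "v0 $ j \<noteq> 0"
    by (auto simp: vec_eq_iff)
  let ?g = "\<lambda>a. (t0 * emb a, inverse a *s v0)"
  have "{(t, v). t \<noteq> 0 \<and> v \<noteq> 0 \<and> outer emb t v = outer emb t0 v0} = ?g ` (UNIV - {0})"
  proof safe
    fix t v assume tv: "t \<noteq> 0" "v \<noteq> 0" and eq: "outer emb t v = outer emb t0 v0"
    have c: "t * emb (v $ i) = t0 * emb (v0 $ i)" for i
      using eq by (simp add: outer_def vec_eq_iff)
    have vj: "v $ j \<noteq> 0" using c[of j] j assms by auto
    \<comment> \<open>The scalar is forced: \<open>v = inverse a *s v0\<close>, read at a coordinate
      where \<open>v0\<close> is nonzero, determines \<open>a\<close>.\<close>
    let ?a = "v0 $ j / v $ j"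
    have "emb ?a * emb (v $ j) = emb (v0 $ j)"
      using vj by (simp flip: emb_mult)
    then have t: "t = t0 * emb ?a"
      using c[of j] vj by (metis (no_types, lifting) emb_eq_0_iff mult.assoc mult_right_cancel)
    have "t0 * emb (?a * v $ i) = t0 * emb (v0 $ i)" for i
      using c[of i] t by (simp only: emb_mult mult.assoc)
    then have "?a * v $ i = v0 $ i" for i
      using assms by (metis emb_eq_iff mult_left_cancel)
    then have "v = inverse ?a *s v0"
      using vj j by (simp add: vec_eq_iff field_simps)
    then show "(t, v) \<in> ?g ` (UNIV - {0})"
      using t vj j by (intro image_eqI[of _ _ ?a]) auto
  next
    fix a :: 'k assume "a \<noteq> 0"
    then have "emb a * emb (inverse a * b) = emb b" for b
      by (simp flip: emb_mult add: mult.assoc[symmetric])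
    then show "outer emb (t0 * emb a) (inverse a *s v0) = outer emb t0 v0"
      by (simp add: outer_def vec_eq_iff mult.assoc)
  qed (use assms in \<open>auto simp: vec_eq_iff\<close>)
  moreover have "inj_on ?g (UNIV - {0})"
    using assms by (auto simp: inj_on_def)
  ultimately show ?thesis
    by (simp add: card_image card_Diff_singleton)
qed

text \<open>This reduces counting rank-one vectors to counting pairs \<open>(t, v)\<close>. The
  factor \<open>q - 1\<close> is kept on the left in all later counts to avoid division in the
  naturals.\<close>

lemma card_outer_preimage:
  fixes Y :: "('f ^ 'n) set"
  assumes "\<And>y. y \<in> Y \<Longrightarrow> rank_weight emb y \<le> 1" "0 \<notin> Y"
  shows "card {(t, v). t \<noteq> 0 \<and> v \<noteq> 0 \<and> outer emb t v \<in> Y} = (CARD('k) - 1) * card Y"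
proof -
  have "{(t, v). t \<noteq> 0 \<and> v \<noteq> 0 \<and> outer emb t v \<in> Y} =
      (\<Union>y\<in>Y. {(t, v). t \<noteq> 0 \<and> v \<noteq> 0 \<and> outer emb t v = y})" by auto
  also have "card \<dots> = (\<Sum>y\<in>Y. card {(t, v). t \<noteq> 0 \<and> v \<noteq> 0 \<and> outer emb t v = y})"
    by (rule card_UN_disjoint) auto
  also have "\<dots> = (\<Sum>y\<in>Y. CARD('k) - 1)"
  proof (rule sum.cong)
    fix y assume "y \<in> Y"
    then obtain t v where "t \<noteq> 0" "v \<noteq> 0" "y = outer emb t v"
      using assms by (metis rank_weight_le_1E)
    then show "card {(t, v). t \<noteq> 0 \<and> v \<noteq> 0 \<and> outer emb t v = y} = CARD('k) - 1"
      using card_outer_fiber by simp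
  qed simp
  finally show ?thesis by simp
qed

section \<open>Solution counts of linear equations\<close>

lemma card_dot_eq:
  fixes w :: "'k ^ 'n"
  assumes "w \<noteq> 0"
  shows "card {v. dot w v = a} = CARD('k) ^ (CARD('n) - 1)"
proof -
  from assms obtain i where i: "w $ i \<noteq> 0" by (auto simp: vec_eq_iff)
  have ex: "\<exists>v. dot w v = b" for b
    by (rule exI[of _ "axis i (b / w $ i)"]) (simp add: i)
  then have "range (dot w) = UNIV" by (metis surjI surj_def)
  then have "CARD('k) * card {v. dot w v = 0} = CARD('k) ^ CARD('n)"
    using card_range_times_kernel[of "dot w", OF dot_add_right] by simp
  then have "CARD('k) * card {v. dot w v = 0} = CARD('k) * CARD('k) ^ (CARD('n) - 1)"
    by (simp flip: power_Suc)
  moreover obtain v0 where "dot w v0 = a" using ex by blast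
  ultimately show ?thesis
    using card_fiber_additive[of "dot w" v0, OF dot_add_right] by simp
qed

text \<open>Independence makes the system solvable, so its solution set is as large as the kernel;
  the kernel is large because the image has at most \<open>q\<close> squared elements. A lower bound
  is all that is used later.\<close>

lemma card_dot_eq2_ge:
  fixes u w :: "'k ^ 'n"
  assumes "u \<noteq> 0" and indep: "\<And>a. w \<noteq> a *s u" and n: "2 \<le> CARD('n)"
  shows "CARD('k) ^ (CARD('n) - 2) \<le> card {v. dot u v = a \<and> dot w v = b}"
proof -
  let ?f = "\<lambda>v. (dot u v, dot w v)"
  have add: "?f (x + y) = ?f x + ?f y" for x y
    by (simp add: dot_add_right)
  from \<open>u \<noteq> 0\<close> obtain i where i: "u $ i \<noteq> 0" by (auto simp: vec_eq_iff)
  have "\<exists>j. w $ j \<noteq> (w $ i / u $ i) * u $ j"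
    using indep[of "w $ i / u $ i"] by (auto simp: vec_eq_iff)
  then obtain j where j: "w $ j \<noteq> (w $ i / u $ i) * u $ j" by blast
  then have D: "w $ j * u $ i - w $ i * u $ j \<noteq> 0"
    using i by (auto simp: field_simps)
  \<comment> \<open>Cramer's rule on coordinates \<open>i\<close> and \<open>j\<close>:
    \<open>s\<close> is the entry at \<open>j\<close>, and the equation for \<open>u\<close> then
    fixes the entry at \<open>i\<close>.\<close>
  define s where "s = (b * u $ i - w $ i * a) / (w $ j * u $ i - w $ i * u $ j)"
  define v0 where "v0 = axis i ((a - u $ j * s) / u $ i) + axis j s"
  have s: "s * (w $ j * u $ i - w $ i * u $ j) = b * u $ i - w $ i * a"
    using D by (simp add: s_def)
  have "dot u v0 = a"
    using i by (simp add: v0_def dot_add_right)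
  moreover have "u $ i * dot w v0 = u $ i * b"
    using i s by (simp add: v0_def dot_add_right field_simps)
  ultimately have v0: "?f v0 = (a, b)" using i by simp
  have "card (range ?f) \<le> CARD('k \<times> 'k)"
    by (rule card_mono) auto
  then have "card (range ?f) * card {v. ?f v = 0} \<le> CARD('k)\<^sup>2 * card {v. ?f v = 0}"
    by (intro mult_le_mono1) (simp add: power2_eq_square)
  then have "CARD('k) ^ CARD('n) \<le> CARD('k)\<^sup>2 * card {v. ?f v = 0}"
    unfolding card_range_times_kernel[of ?f, OF add] by (simp only: CARD_vec)
  moreover have "CARD('k) ^ CARD('n) = CARD('k)\<^sup>2 * CARD('k) ^ (CARD('n) - 2)"
    using n by (metis le_add_diff_inverse power_add)
  ultimately have "CARD('k) ^ (CARD('n) - 2) \<le> card {v. ?f v = 0}"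
    using card_ground_gt_1 by simp
  then show ?thesis
    using card_fiber_additive[of ?f v0, OF add] v0 by simp
qed

lemma card_pairing_eq_0:
  fixes u :: "'k ^ 'n"
  assumes "u \<noteq> 0"
  shows "card {x. pairing emb u x = 0} = CARD('f) ^ (CARD('n) - 1)"
proof -
  from assms obtain i where i: "u $ i \<noteq> 0" by (auto simp: vec_eq_iff)
  have "\<exists>x. pairing emb u x = b" for b
    by (rule exI[of _ "axis i (b / emb (u $ i))"]) (simp add: i)
  then have "range (pairing emb u) = UNIV" by (metis surjI surj_def)
  then have "CARD('f) * card {x. pairing emb u x = 0} = CARD('f) ^ CARD('n)"
    using card_range_times_kernel[of "pairing emb u", OF pairing_add_right] by simp
  then have "CARD('f) * card {x. pairing emb u x = 0} = CARD('f) * CARD('f) ^ (CARD('n) - 1)"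
    by (simp flip: power_Suc)
  then show ?thesis by simp
qed

section \<open>Rank-one perturbations\<close>

text \<open>Here every pair of nonzero \<open>t\<close> and \<open>v\<close> is admissible; up to
  the factor \<open>q - 1\<close> this is \<open>v(1) - 1\<close>.\<close>

lemma card_nonzero_rank_le_1:
  "(CARD('k) - 1) * card {y :: 'f ^ 'n. rank_weight emb y \<le> 1 \<and> y \<noteq> 0} =
    (CARD('f) - 1) * (CARD('k) ^ CARD('n) - 1)"
proof -
  let ?Y = "{y :: 'f ^ 'n. rank_weight emb y \<le> 1 \<and> y \<noteq> 0}"
  have "(CARD('k) - 1) * card ?Y = card {(t, v :: 'k ^ 'n). t \<noteq> 0 \<and> v \<noteq> 0 \<and> outer emb t v \<in> ?Y}"
    by (rule card_outer_preimage[symmetric]) auto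
  also have "{(t, v :: 'k ^ 'n). t \<noteq> 0 \<and> v \<noteq> 0 \<and> outer emb t v \<in> ?Y} = (UNIV - {0}) \<times> (UNIV - {0})"
    by (auto simp: outer_nonzero rank_weight_outer_le[simplified])
  also have "card \<dots> = (CARD('f) - 1) * (CARD('k) ^ CARD('n) - 1)"
    by (simp add: card_cartesian_product card_Diff_singleton)
  finally show ?thesis .
qed

text \<open>The source of \<alpha>. Since \<open>c\<close> has trivial kernel, a rank-lowering pair
  \<open>(t, v)\<close> corresponds to a unique \<open>w\<close> with
  \<open>pairing emb w c = t\<close> and \<open>dot w v = -1\<close>; each nonzero \<open>w\<close>
  leaves one linear equation for \<open>v\<close>.\<close>

lemma card_lowering_full_rank:
  fixes c :: "'f ^ 'n"
  assumes c: "rank_weight emb c = CARD('n)"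
  shows "(CARD('k) - 1) * card {y. rank_weight emb y \<le> 1 \<and> rank_weight emb (c + y) \<le> CARD('n) - 1} =
    (CARD('k) ^ CARD('n) - 1) * CARD('k) ^ (CARD('n) - 1)"
proof -
  let ?Y = "{y. rank_weight emb y \<le> 1 \<and> rank_weight emb (c + y) \<le> CARD('n) - 1}"
  let ?S = "Sigma (UNIV - {0}) (\<lambda>w :: 'k ^ 'n. {v. dot w v = -1})"
  let ?g = "\<lambda>(w, v :: 'k ^ 'n). (pairing emb w c, v)"
  have n: "0 < CARD('n)" by simp
  then have c0: "\<not> rank_weight emb c \<le> CARD('n) - 1"
    unfolding c by linarith
  have ker: "u = 0" if "pairing emb u c = 0" for u
    using that c by (simp add: rank_weight_full_iff)
  have Y_iff: "outer emb t v \<in> ?Y \<longleftrightarrow> (\<exists>u. u \<noteq> 0 \<and> pairing emb u c + t * emb (dot u v) = 0)" for t v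
  proof -
    have "outer emb t v \<in> ?Y \<longleftrightarrow> rank_weight emb (c + outer emb t v) \<noteq> CARD('n)"
      using rank_weight_le[of "c + outer emb t v"] n rank_weight_outer_le[of t v]
      unfolding mem_Collect_eq by linarith
    then show ?thesis
      by (auto simp: rank_weight_full_iff pairing_add_right pairing_outer)
  qed
  have "(CARD('k) - 1) * card ?Y = card {(t, v). t \<noteq> 0 \<and> v \<noteq> 0 \<and> outer emb t v \<in> ?Y}"
    by (rule card_outer_preimage[symmetric]) (use c0 in auto)
  \<comment> \<open>Any \<open>t\<close> lowering the rank lies in the span of \<open>c\<close>; take its coefficient vector \<open>w\<close> as parameter.\<close>
  also have "{(t, v). t \<noteq> 0 \<and> v \<noteq> 0 \<and> outer emb t v \<in> ?Y} = ?g ` ?S"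
  proof (intro set_eqI iffI)
    fix p assume "p \<in> {(t, v). t \<noteq> 0 \<and> v \<noteq> 0 \<and> outer emb t v \<in> ?Y}"
    then obtain t v where p: "p = (t, v)" "t \<noteq> 0" and Y: "outer emb t v \<in> ?Y" by blast
    from Y obtain u where u: "u \<noteq> 0" "pairing emb u c + t * emb (dot u v) = 0"
      unfolding Y_iff by blast
    have s: "dot u v \<noteq> 0" using ker u by auto
    \<comment> \<open>The kernel vector \<open>u\<close> is rescaled so that \<open>dot w v\<close>
      is -1; its kernel equation then reads \<open>pairing emb w c = t\<close>.\<close>
    define w where "w = (- 1 / dot u v) *s u"
    have w: "dot w v = - 1" using s by (simp add: w_def dot_scale_left)
    have "pairing emb u c = - (t * emb (dot u v))"
      using u(2) by (simp add: eq_neg_iff_add_eq_0)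
    then have "pairing emb w c = - t * (emb (- 1 / dot u v) * emb (dot u v))"
      by (simp add: w_def pairing_scale_left ac_simps)
    also have "\<dots> = t"
      using s by (simp flip: emb_mult) (simp add: emb_uminus emb_one)
    finally show "p \<in> ?g ` ?S"
      using w p by (intro image_eqI[of _ _ "(w, v)"]) (auto simp: dot_def)
  next
    fix p assume "p \<in> ?g ` ?S"
    then obtain w v where p: "p = (pairing emb w c, v)" and w: "w \<noteq> 0" "dot w v = - 1" by auto
    have "v \<noteq> 0" using w(2) by (auto simp: dot_def)
    moreover have "pairing emb w c \<noteq> 0" using ker w(1) by blast
    moreover have "outer emb (pairing emb w c) v \<in> ?Y"
      unfolding Y_iff using w by (intro exI[of _ w]) (simp add: emb_uminus emb_one)
    ultimately show "p \<in> {(t, v). t \<noteq> 0 \<and> v \<noteq> 0 \<and> outer emb t v \<in> ?Y}"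
      using p by simp
  qed
  also have "card (?g ` ?S) = card ?S"
  proof (rule card_image)
    have "w = w'" if "pairing emb w c = pairing emb w' c" for w w'
      using ker[of "w - w'"] pairing_add_left[of "w - w'" w' c] that by simp
    then show "inj_on ?g ?S" by (auto simp: inj_on_def)
  qed
  also have "\<dots> = (\<Sum>w\<in>UNIV - {0 :: 'k ^ 'n}. CARD('k) ^ (CARD('n) - 1))"
    by (subst card_SigmaI) (auto simp: card_dot_eq)
  also have "\<dots> = (CARD('k) ^ CARD('n) - 1) * CARD('k) ^ (CARD('n) - 1)"
    by (simp add: card_Diff_singleton)
  finally show ?thesis .
qed

text \<open>The kernel has exactly \<open>q\<close> elements, so the \<open>q\<close> multiples of
  any nonzero member fill it.\<close>

lemma corank_1_kernelE:
  fixes c :: "'f ^ 'n"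
  assumes c: "rank_weight emb c = CARD('n) - 1"
  obtains u where "u \<noteq> 0" "{v. pairing emb v c = 0} = range (\<lambda>a. a *s u)"
proof -
  have card: "card {v. pairing emb v c = 0} = CARD('k)"
    by (simp add: card_kernel_pairing c)
  have "\<not> {v. pairing emb v c = 0} \<subseteq> {0}"
  proof
    assume "{v. pairing emb v c = 0} \<subseteq> {0}"
    then have "card {v. pairing emb v c = 0} \<le> card {0 :: 'k ^ 'n}"
      by (intro card_mono) auto
    then show False using card card_ground_gt_1 by simp
  qed
  then obtain u where u: "u \<noteq> 0" "pairing emb u c = 0" by auto
  have "inj (\<lambda>a. a *s u)"
    using u(1) by (auto simp: inj_def vec_eq_iff)
  then have "card (range (\<lambda>a. a *s u)) = CARD('k)"
    by (rule card_image)
  moreover have "range (\<lambda>a. a *s u) \<subseteq> {v. pairing emb v c = 0}"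
    using u by (auto simp: pairing_scale_left)
  ultimately have "range (\<lambda>a. a *s u) = {v. pairing emb v c = 0}"
    using card by (intro card_subset_eq) auto
  then show thesis using u that by blast
qed

text \<open>The rank rises exactly when \<open>t\<close> is outside the span of the coordinates of
  \<open>c\<close> and \<open>v\<close> is not orthogonal to the kernel vector \<open>u0\<close>.
  The two conditions are independent, which gives a product.\<close>

lemma card_raising_corank_1:
  fixes c :: "'f ^ 'n"
  assumes c: "rank_weight emb c = CARD('n) - 1"
  shows "(CARD('k) - 1) * card {y. rank_weight emb y \<le> 1 \<and> rank_weight emb (c + y) = CARD('n)} =
    (CARD('f) - CARD('k) ^ (CARD('n) - 1)) * (CARD('k) ^ CARD('n) - CARD('k) ^ (CARD('n) - 1))"
proof -
  let ?Y = "{y. rank_weight emb y \<le> 1 \<and> rank_weight emb (c + y) = CARD('n)}"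
  let ?R = "range (\<lambda>u. pairing emb u c)"
  have n: "0 < CARD('n)" by simp
  from corank_1_kernelE[OF c] obtain u0
    where u0: "u0 \<noteq> 0" and ker: "{v. pairing emb v c = 0} = range (\<lambda>a. a *s u0)" by metis
  have c0: "rank_weight emb c \<noteq> CARD('n)"
    using c n by linarith
  have u0_ker: "pairing emb u0 c = 0"
  proof -
    have "1 *s u0 \<in> {v. pairing emb v c = 0}" unfolding ker by blast
    then show ?thesis by simp
  qed
  have Y_iff: "outer emb t v \<in> ?Y \<longleftrightarrow> (\<forall>u. pairing emb u c + t * emb (dot u v) = 0 \<longrightarrow> u = 0)" for t v
    using rank_weight_outer_le[of t v]
    by (simp add: rank_weight_full_iff pairing_add_right pairing_outer)
  have "(CARD('k) - 1) * card ?Y = card {(t, v). t \<noteq> 0 \<and> v \<noteq> 0 \<and> outer emb t v \<in> ?Y}"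
    by (rule card_outer_preimage[symmetric]) (use c0 in auto)
  also have "{(t, v). t \<noteq> 0 \<and> v \<noteq> 0 \<and> outer emb t v \<in> ?Y} = (UNIV - ?R) \<times> (UNIV - {v. dot u0 v = 0})"
  proof (intro set_eqI iffI)
    fix p assume "p \<in> {(t, v). t \<noteq> 0 \<and> v \<noteq> 0 \<and> outer emb t v \<in> ?Y}"
    then obtain t v where p: "p = (t, v)" and Y: "outer emb t v \<in> ?Y" by blast
    have "t \<notin> ?R"
    proof
      assume "t \<in> ?R"
      then obtain w where "t = pairing emb w c" by blast
      \<comment> \<open>For \<open>t\<close> in the span, the perturbation is absorbed into the
        argument \<open>u\<close>, so the image cannot grow.\<close>
      then have "pairing emb u (c + outer emb t v) = pairing emb (u + dot u v *s w) c" for u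
        by (simp add: pairing_add_right pairing_add_left pairing_scale_left pairing_outer)
      then have "range (\<lambda>u. pairing emb u (c + outer emb t v)) \<subseteq> ?R" by auto
      then have "card (range (\<lambda>u. pairing emb u (c + outer emb t v))) \<le> card ?R"
        by (rule card_mono[rotated]) simp
      then have "rank_weight emb (c + outer emb t v) \<le> CARD('n) - 1"
        by (simp add: rank_weight_le_iff_range card_range_pairing c)
      then show False using Y n unfolding mem_Collect_eq by linarith
    qed
    moreover have "dot u0 v \<noteq> 0"
      using Y[unfolded Y_iff] u0 u0_ker by auto
    ultimately show "p \<in> (UNIV - ?R) \<times> (UNIV - {v. dot u0 v = 0})" using p by simp
  next
    fix p assume "p \<in> (UNIV - ?R) \<times> (UNIV - {v. dot u0 v = 0})"
    then obtain t v where p: "p = (t, v)" and t: "t \<notin> ?R" and v: "dot u0 v \<noteq> 0" by blast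
    have "t \<noteq> 0" using t pairing_zero_left[of c] by (metis rangeI)
    moreover have "v \<noteq> 0" using v by (auto simp: dot_def)
    moreover have "outer emb t v \<in> ?Y"
      unfolding Y_iff
    proof (intro allI impI)
      fix u assume u: "pairing emb u c + t * emb (dot u v) = 0"
      \<comment> \<open>Otherwise the equation could be solved for \<open>t\<close>, placing it in
        the span of the coordinates of \<open>c\<close>.\<close>
      have "dot u v = 0"
      proof (rule ccontr)
        assume s: "dot u v \<noteq> 0"
        have "pairing emb ((- 1 / dot u v) *s u) c = - t * (emb (- 1 / dot u v) * emb (dot u v))"
          using u by (simp add: pairing_scale_left eq_neg_iff_add_eq_0[symmetric])
        also have "\<dots> = t"
          using s by (simp flip: emb_mult) (simp add: emb_uminus emb_one)
        finally show False using t by (metis rangeI)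
      qed
      then have "u \<in> range (\<lambda>a. a *s u0)"
        using u by (simp flip: ker)
      then obtain a where "u = a *s u0" by blast
      then show "u = 0" using \<open>dot u v = 0\<close> v by (simp add: dot_scale_left)
    qed
    ultimately show "p \<in> {(t, v). t \<noteq> 0 \<and> v \<noteq> 0 \<and> outer emb t v \<in> ?Y}" using p by simp
  qed
  also have "card \<dots> = (CARD('f) - CARD('k) ^ (CARD('n) - 1)) * (CARD('k) ^ CARD('n) - CARD('k) ^ (CARD('n) - 1))"
    using card_dot_eq[OF u0, of 0] by (simp add: card_cartesian_product card_Diff_subset card_range_pairing c)
  finally show ?thesis .
qed

text \<open>
  If \<open>t = pairing emb w c\<close>, \<open>dot u0 v = 0\<close> and \<open>dot w v = -1\<close>, where \<open>u0\<close> spans the kernel of \<open>c\<close>,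
  then both \<open>u0\<close> and \<open>w\<close> lie in the kernel of \<open>c + outer emb t v\<close>.
\<close>

lemma card_lowering_corank_1_ge:
  fixes c :: "'f ^ 'n"
  assumes c: "rank_weight emb c = CARD('n) - 1" and n: "2 \<le> CARD('n)"
  shows "(CARD('k) ^ (CARD('n) - 1) - 1) * CARD('k) ^ (CARD('n) - 2) \<le>
    (CARD('k) - 1) * card {y. rank_weight emb y \<le> 1 \<and> rank_weight emb (c + y) \<le> CARD('n) - 2}"
proof -
  let ?Y = "{y. rank_weight emb y \<le> 1 \<and> rank_weight emb (c + y) \<le> CARD('n) - 2}"
  let ?R = "range (\<lambda>u. pairing emb u c)"
  from corank_1_kernelE[OF c] obtain u0
    where u0: "u0 \<noteq> 0" and ker: "{v. pairing emb v c = 0} = range (\<lambda>a. a *s u0)" by metis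
  have mult_ker: "pairing emb (a *s u0) c = 0" for a
    using ker by blast
  have "\<forall>t\<in>?R. \<exists>u. pairing emb u c = t" by blast
  then obtain w where w: "\<And>t. t \<in> ?R \<Longrightarrow> pairing emb (w t) c = t"
    unfolding bchoice_iff by blast
  \<comment> \<open>Multiples of \<open>u0\<close> pair to 0 with \<open>c\<close> while
    \<open>w t\<close> pairs to \<open>t\<close>, which is nonzero; so the two equations imposed on
    \<open>v\<close> are independent.\<close>
  have indep: "w t \<noteq> a *s u0" if "t \<in> ?R - {0}" for t a
    using w[of t] mult_ker[of a] that by auto
  let ?S = "Sigma (?R - {0}) (\<lambda>t. {v. dot u0 v = 0 \<and> dot (w t) v = -1})"
  have "?S \<subseteq> {(t, v). t \<noteq> 0 \<and> v \<noteq> 0 \<and> outer emb t v \<in> ?Y}"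
  proof
    fix p assume "p \<in> ?S"
    then obtain t v where p: "p = (t, v)" and t: "t \<in> ?R - {0}"
      and v: "dot u0 v = 0" "dot (w t) v = - 1" by blast
    let ?x = "c + outer emb t v"
    let ?K = "{u. pairing emb u ?x = 0}"
    have "v \<noteq> 0" using v(2) by (auto simp: dot_def)
    have "pairing emb (w t) c = t" using w t by blast
    then have "insert (w t) (range (\<lambda>a. a *s u0)) \<subseteq> ?K"
      using v mult_ker
      by (auto simp: pairing_add_right pairing_outer dot_scale_left emb_uminus emb_one)
    then have "card (insert (w t) (range (\<lambda>a. a *s u0))) \<le> card ?K"
      by (rule card_mono[rotated]) simp
    moreover have "w t \<notin> range (\<lambda>a. a *s u0)" using indep[OF t] by blast
    moreover have "card (range (\<lambda>a. a *s u0)) = CARD('k)"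
      using c n by (simp flip: ker add: card_kernel_pairing)
    \<comment> \<open>The kernel has more than \<open>q\<close> elements and its size is a power of
      \<open>q\<close>, so the exponent is at least 2.\<close>
    ultimately have "CARD('k) ^ 1 < CARD('k) ^ (CARD('n) - rank_weight emb ?x)"
      by (simp add: card_kernel_pairing)
    then have "1 < CARD('n) - rank_weight emb ?x"
      using card_ground_gt_1 by (simp only: power_strict_increasing_iff)
    then show "p \<in> {(t, v). t \<noteq> 0 \<and> v \<noteq> 0 \<and> outer emb t v \<in> ?Y}"
      using p t \<open>v \<noteq> 0\<close> rank_weight_outer_le[of t v] by simp
  qed
  then have "card ?S \<le> card {(t, v). t \<noteq> 0 \<and> v \<noteq> 0 \<and> outer emb t v \<in> ?Y}"
    by (rule card_mono[rotated]) simp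
  also have "\<dots> = (CARD('k) - 1) * card ?Y"
    by (rule card_outer_preimage) (use c n in auto)
  also have "card ?S = (\<Sum>t\<in>?R - {0}. card {v. dot u0 v = 0 \<and> dot (w t) v = -1})"
    by (rule card_SigmaI) auto
  finally have "(\<Sum>t\<in>?R - {0}. card {v. dot u0 v = 0 \<and> dot (w t) v = -1}) \<le> (CARD('k) - 1) * card ?Y" .
  moreover have "(\<Sum>t\<in>?R - {0}. CARD('k) ^ (CARD('n) - 2)) \<le>
      (\<Sum>t\<in>?R - {0}. card {v. dot u0 v = 0 \<and> dot (w t) v = -1})"
    by (intro sum_mono card_dot_eq2_ge u0 indep n)
  moreover have "0 \<in> ?R" using mult_ker by (metis rangeI)
  ultimately show ?thesis
    by (simp add: card_Diff_singleton card_range_pairing c)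
qed

text \<open>Count the pairs \<open>(u, x)\<close> with \<open>u \<noteq> 0\<close> and \<open>pairing emb u x = 0\<close> in two ways.\<close>

lemma card_rank_deficient_le:
  assumes n: "2 \<le> CARD('n)"
  shows "(CARD('k) - 1) * (card {x :: 'f ^ 'n. rank_weight emb x \<le> CARD('n) - 1} +
      card {x :: 'f ^ 'n. rank_weight emb x \<le> CARD('n) - 2}) \<le>
    (CARD('k) ^ CARD('n) - 1) * CARD('f) ^ (CARD('n) - 1)"
proof -
  let ?q = "CARD('k)"
  let ?A = "\<lambda>r. {x :: 'f ^ 'n. rank_weight emb x \<le> r}"
  have card_eq_sum: "card (?A r) = (\<Sum>x::'f^'n\<in>UNIV. of_bool (rank_weight emb x \<le> r))" for r
    by (simp add: of_bool_def sum.If_cases)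
  have "(?q - 1) * (card (?A (CARD('n) - 1)) + card (?A (CARD('n) - 2))) =
      (\<Sum>x::'f^'n\<in>UNIV. (?q - 1) * (of_bool (rank_weight emb x \<le> CARD('n) - 1) +
        of_bool (rank_weight emb x \<le> CARD('n) - 2)))"
    unfolding card_eq_sum by (simp only: sum.distrib sum_distrib_left distrib_left)
  also have "\<dots> \<le> (\<Sum>x::'f^'n\<in>UNIV. card {u \<in> UNIV - {0}. pairing emb u x = 0})"
  proof (rule sum_mono)
    fix x :: "'f ^ 'n"
    let ?d = "CARD('n) - rank_weight emb x"
    have "{u \<in> UNIV - {0}. pairing emb u x = 0} = {u. pairing emb u x = 0} - {0}" by auto
    then have card: "card {u \<in> UNIV - {0}. pairing emb u x = 0} = ?q ^ ?d - 1"
      by (simp add: card_Diff_singleton card_kernel_pairing)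
    have q: "1 < ?q" by (rule card_ground_gt_1)
    \<comment> \<open>With corank \<open>?d\<close>, the left side is \<open>2(q - 1)\<close>,
      \<open>q - 1\<close> or 0 in the three cases, against \<open>q ^ ?d - 1\<close> on the
      right.\<close>
    consider "2 \<le> ?d" | "?d = 1" | "?d = 0" by linarith
    then show "(?q - 1) * (of_bool (rank_weight emb x \<le> CARD('n) - 1) +
        of_bool (rank_weight emb x \<le> CARD('n) - 2)) \<le> card {u \<in> UNIV - {0}. pairing emb u x = 0}"
      unfolding card
    proof cases
      case 1
      then have "?q\<^sup>2 \<le> ?q ^ ?d" using q by (simp add: power_increasing)
      moreover have "2 * ?q \<le> ?q\<^sup>2" using q by (simp add: power2_eq_square)
      moreover have "rank_weight emb x \<le> CARD('n) - 1" "rank_weight emb x \<le> CARD('n) - 2"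
        using 1 by auto
      ultimately show "(?q - 1) * (of_bool (rank_weight emb x \<le> CARD('n) - 1) +
          of_bool (rank_weight emb x \<le> CARD('n) - 2)) \<le> ?q ^ ?d - 1" by simp
    next
      case 2
      then have "\<not> rank_weight emb x \<le> CARD('n) - 2" using n by linarith
      then show "(?q - 1) * (of_bool (rank_weight emb x \<le> CARD('n) - 1) +
          of_bool (rank_weight emb x \<le> CARD('n) - 2)) \<le> ?q ^ ?d - 1" using 2 by simp
    next
      case 3
      then have "\<not> rank_weight emb x \<le> CARD('n) - 2" "\<not> rank_weight emb x \<le> CARD('n) - 1"
        using n by linarith+
      then show "(?q - 1) * (of_bool (rank_weight emb x \<le> CARD('n) - 1) +
          of_bool (rank_weight emb x \<le> CARD('n) - 2)) \<le> ?q ^ ?d - 1" by simp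
    qed
  qed
  also have "\<dots> = (\<Sum>u\<in>UNIV - {0}. card {x :: 'f ^ 'n \<in> UNIV. pairing emb u x = 0})"
    by (rule sum_multicount_gen) auto
  also have "\<dots> = (\<Sum>u\<in>UNIV - {0 :: 'k ^ 'n}. CARD('f) ^ (CARD('n) - 1))"
    by (intro sum.cong) (auto simp: card_pairing_eq_0)
  also have "\<dots> = (CARD('k) ^ CARD('n) - 1) * CARD('f) ^ (CARD('n) - 1)"
    by (simp add: card_Diff_singleton)
  finally show ?thesis .
qed

section \<open>Excess of a covering\<close>

text \<open>This trades the nested \<open>Min\<close> and \<open>Max\<close> for an optimal code
  with a pointwise covering property; the whole space shows that the outer \<open>Min\<close> is
  attained.\<close>

lemma min_rank_covering_sizeE:
  obtains C :: "('f ^ 'n) set"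
  where "card C = min_rank_covering_size emb TYPE('n) \<rho>"
    and "\<And>x. \<exists>c\<in>C. rank_weight emb (x - c) \<le> \<rho>"
proof -
  let ?\<C> = "{C :: ('f ^ 'n) set. C \<noteq> {} \<and> rank_covering_radius emb C \<le> \<rho>}"
  have "rank_covering_radius emb (UNIV :: ('f ^ 'n) set) \<le> \<rho>"
  proof -
    have "Min (range (rank_dist emb x)) \<le> 0" for x :: "'f ^ 'n"
      by (rule Min_le) (auto intro!: range_eqI[of _ _ x] simp: rank_dist_def)
    then show ?thesis by (auto simp: rank_covering_radius_def)
  qed
  then have "UNIV \<in> ?\<C>" by simp
  then have "card ` ?\<C> \<noteq> {}" by blast
  then have "Min (card ` ?\<C>) \<in> card ` ?\<C>"
    by (intro Min_in) auto
  then obtain C where C: "C \<in> ?\<C>" and "card C = min_rank_covering_size emb TYPE('n) \<rho>"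
    unfolding min_rank_covering_size_def by (metis (no_types, lifting) imageE)
  moreover have "\<exists>c\<in>C. rank_weight emb (x - c) \<le> \<rho>" for x
  proof -
    have "Min ((\<lambda>c. rank_dist emb x c) ` C) \<le> \<rho>"
      using C by (auto simp: rank_covering_radius_def)
    moreover have "Min ((\<lambda>c. rank_dist emb x c) ` C) \<in> (\<lambda>c. rank_dist emb x c) ` C"
      using C by (intro Min_in) auto
    ultimately show ?thesis
      by (auto simp: rank_dist_def)
  qed
  ultimately show thesis using that by blast
qed

lemma rank_ball_eq: "rank_ball emb c r = {x. rank_weight emb (x - c) \<le> r}"
  by (simp add: rank_ball_def rank_dist_def)

lemma rank_ball_volume_eq:
  "rank_ball_volume emb TYPE('n::finite) r = card {x :: 'f ^ 'n. rank_weight emb x \<le> r}"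
  by (simp add: rank_ball_volume_def rank_ball_eq)

text \<open>Translation by \<open>x\<close> turns ball intersections into perturbations of
  \<open>x - c\<close>, to which the rank-one counts apply.\<close>

lemma card_ball_inter_ball:
  "card (rank_ball emb x 1 \<inter> rank_ball emb c r) =
    card {y. rank_weight emb y \<le> 1 \<and> rank_weight emb (x - c + y) \<le> r}"
proof (rule bij_betw_same_card)
  show "bij_betw (\<lambda>y. y - x) (rank_ball emb x 1 \<inter> rank_ball emb c r)
      {y. rank_weight emb y \<le> 1 \<and> rank_weight emb (x - c + y) \<le> r}"
    by (rule bij_betw_byWitness[where f' = "\<lambda>y. x + y"]) (auto simp: rank_ball_eq add_diff_eq algebra_simps)
qed

section \<open>The perturbation counts over the reals, with \<open>q - 1\<close> divided out\<close>

lemma real_card_lowering_full_rank: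
  fixes c :: "'f ^ 'n"
  assumes c: "rank_weight emb c = CARD('n)"
  shows "real (card {y. rank_weight emb y \<le> 1 \<and> rank_weight emb (c + y) \<le> CARD('n) - 1}) =
    real CARD('k) ^ (CARD('n) - 1) * gauss1 CARD('k) CARD('n)" (is "real ?L = _")
proof -
  have q: "1 < CARD('k)" by (rule card_ground_gt_1)
  have "real ((CARD('k) - 1) * ?L) = real ((CARD('k) ^ CARD('n) - 1) * CARD('k) ^ (CARD('n) - 1))"
    by (simp only: card_lowering_full_rank[OF c])
  then have "(real CARD('k) - 1) * real ?L =
      (real CARD('k) ^ CARD('n) - 1) * real CARD('k) ^ (CARD('n) - 1)"
    using q by (simp add: of_nat_diff)
  then show ?thesis using q by (simp add: gauss1_def field_simps)
qed

lemma real_card_raising_corank_1: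
  fixes c :: "'f ^ 'n"
  assumes c: "rank_weight emb c = CARD('n) - 1"
  shows "real (card {y. rank_weight emb y \<le> 1 \<and> rank_weight emb (c + y) = CARD('n)}) =
    real CARD('k) ^ (CARD('n) - 1) * (real CARD('f) - real CARD('k) ^ (CARD('n) - 1))"
    (is "real ?L = _")
proof -
  let ?q = "CARD('k)"
  have q: "1 < ?q" by (rule card_ground_gt_1)
  \<comment> \<open>The coordinate span has \<open>q ^ (n - 1)\<close> elements inside
    \<open>'f\<close>, so the natural subtraction is exact.\<close>
  have "card (range (\<lambda>u. pairing emb u c)) \<le> CARD('f)"
    by (rule card_mono) auto
  then have le: "?q ^ (CARD('n) - 1) \<le> CARD('f)"
    by (simp only: card_range_pairing c)
  have le': "?q ^ (CARD('n) - 1) \<le> ?q ^ CARD('n)"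
    using q by (intro power_increasing) auto
  have Suc: "real ?q ^ CARD('n) = real ?q * real ?q ^ (CARD('n) - 1)"
    by (simp flip: power_Suc)
  have "real ((?q - 1) * ?L) =
      real ((CARD('f) - ?q ^ (CARD('n) - 1)) * (?q ^ CARD('n) - ?q ^ (CARD('n) - 1)))"
    by (simp only: card_raising_corank_1[OF c])
  also have "\<dots> = (real CARD('f) - real ?q ^ (CARD('n) - 1)) * (real ?q ^ CARD('n) - real ?q ^ (CARD('n) - 1))"
    using le le' by (simp only: of_nat_mult of_nat_diff of_nat_power)
  also have "\<dots> = (real ?q - 1) * (real ?q ^ (CARD('n) - 1) * (real CARD('f) - real ?q ^ (CARD('n) - 1)))"
    unfolding Suc by (simp add: algebra_simps)
  finally have "(real ?q - 1) * real ?L =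
      (real ?q - 1) * (real ?q ^ (CARD('n) - 1) * (real CARD('f) - real ?q ^ (CARD('n) - 1)))"
    using q by (simp add: of_nat_diff)
  moreover have "real ?q - 1 \<noteq> 0" using q by simp
  ultimately show ?thesis using mult_left_cancel by blast
qed

lemma real_card_lowering_corank_1_ge:
  fixes c :: "'f ^ 'n"
  assumes c: "rank_weight emb c = CARD('n) - 1" and n: "2 \<le> CARD('n)"
  shows "real CARD('k) ^ (CARD('n) - 2) * gauss1 CARD('k) (CARD('n) - 1) \<le>
    real (card {y. rank_weight emb y \<le> 1 \<and> rank_weight emb (c + y) \<le> CARD('n) - 2})"
    (is "_ \<le> real ?L")
proof -
  have q: "1 < CARD('k)" by (rule card_ground_gt_1)
  have "real ((CARD('k) ^ (CARD('n) - 1) - 1) * CARD('k) ^ (CARD('n) - 2)) \<le> real ((CARD('k) - 1) * ?L)"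
    using card_lowering_corank_1_ge[OF c n] by (simp only: of_nat_le_iff)
  then have "(real CARD('k) ^ (CARD('n) - 1) - 1) * real CARD('k) ^ (CARD('n) - 2) \<le>
      (real CARD('k) - 1) * real ?L"
    using q by (simp add: of_nat_diff)
  then show ?thesis using q by (simp add: gauss1_def field_simps)
qed

text \<open>This says that \<delta> is nonnegative, as needed when a unit ball contains no barely
  covered vector. Both factors of \<open>card_nonzero_rank_le_1\<close> are bounded below
  separately.\<close>

lemma rank_ball_volume_1_ge:
  assumes Q: "CARD('k) ^ CARD('n) \<le> CARD('f)"
  shows "1 + real CARD('k) ^ (CARD('n) - 2) * gauss1 CARD('k) (CARD('n) - 1) \<le>
    real (rank_ball_volume emb TYPE('n::finite) 1)"
proof -
  let ?q = "CARD('k)"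
  let ?Y = "{y :: 'f ^ 'n. rank_weight emb y \<le> 1 \<and> y \<noteq> 0}"
  have q: "1 < ?q" by (rule card_ground_gt_1)
  have "{y :: 'f ^ 'n. rank_weight emb y \<le> 1} = insert 0 ?Y" by auto
  then have v: "rank_ball_volume emb TYPE('n) 1 = 1 + card ?Y"
    by (simp add: rank_ball_volume_eq)
  \<comment> \<open>Strictness pays for the 1 subtracted from \<open>CARD('f)\<close>.\<close>
  have "?q ^ (CARD('n) - 2) < ?q ^ CARD('n)"
    using q by (intro power_strict_increasing) (use zero_less_card_finite[where 'a = 'n] in linarith)+
  then have "?q ^ (CARD('n) - 2) \<le> CARD('f) - 1" using Q by linarith
  moreover have "?q ^ (CARD('n) - 1) \<le> ?q ^ CARD('n)"
    using q by (intro power_increasing) auto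
  ultimately have "?q ^ (CARD('n) - 2) * (?q ^ (CARD('n) - 1) - 1) \<le> (CARD('f) - 1) * (?q ^ CARD('n) - 1)"
    by (intro mult_le_mono diff_le_mono)
  then have "?q ^ (CARD('n) - 2) * (?q ^ (CARD('n) - 1) - 1) \<le> (?q - 1) * card ?Y"
    by (simp only: card_nonzero_rank_le_1)
  then have "real (?q ^ (CARD('n) - 2) * (?q ^ (CARD('n) - 1) - 1)) \<le> real ((?q - 1) * card ?Y)"
    by (simp only: of_nat_le_iff)
  then have "real ?q ^ (CARD('n) - 2) * (real ?q ^ (CARD('n) - 1) - 1) \<le> (real ?q - 1) * real (card ?Y)"
    using q by (simp add: of_nat_diff)
  then show ?thesis using q unfolding v by (simp add: gauss1_def field_simps)
qed

section \<open>Double counting of the excess\<close>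

definition cover_count :: "('f ^ 'n) set \<Rightarrow> 'f ^ 'n \<Rightarrow> nat" where
  "cover_count C x = card {c \<in> C. x \<in> rank_ball emb c (CARD('n) - 1)}"

text \<open>Excluding the smaller balls puts the only covering codeword at distance exactly
  \<open>n - 1\<close>, so that the corank-one count applies to it.\<close>

definition barely_covered :: "('f ^ 'n) set \<Rightarrow> ('f ^ 'n) set" where
  "barely_covered C = {x. cover_count C x = 1 \<and> (\<forall>c\<in>C. x \<notin> rank_ball emb c (CARD('n) - 2))}"

lemma sum_cover_count:
  fixes C :: "('f ^ 'n) set"
  shows "(\<Sum>x\<in>X. cover_count C x) = (\<Sum>c\<in>C. card (X \<inter> rank_ball emb c (CARD('n) - 1)))"
proof -
  have "(\<Sum>x\<in>X. card {c \<in> C. x \<in> rank_ball emb c (CARD('n) - 1)}) =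
      (\<Sum>c\<in>C. card {x \<in> X. x \<in> rank_ball emb c (CARD('n) - 1)})"
    by (rule sum_multicount_gen) auto
  then show ?thesis
    by (simp add: cover_count_def Int_def)
qed

lemma sum_UNIV_cover_count:
  fixes C :: "('f ^ 'n) set"
  shows "(\<Sum>x\<in>UNIV. cover_count C x) = card C * rank_ball_volume emb TYPE('n) (CARD('n) - 1)"
  by (simp add: sum_cover_count card_rank_ball)

text \<open>The sum is taken codeword by codeword. The covering one, at distance
  \<open>n - 1\<close>, misses only the perturbations that raise its rank to \<open>n\<close>; each
  of the others, at distance \<open>n\<close>, contributes \<alpha>.\<close>

lemma sum_cover_count_ball:
  fixes C :: "('f ^ 'n) set"
  assumes x: "x \<in> barely_covered C" and n: "2 \<le> CARD('n)"
  shows "real (\<Sum>y\<in>rank_ball emb x 1. cover_count C y) =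
    real (rank_ball_volume emb TYPE('n) 1)
      - real CARD('k) ^ (CARD('n) - 1) * (real CARD('f) - real CARD('k) ^ (CARD('n) - 1))
      + (real (card C) - 1) * (real CARD('k) ^ (CARD('n) - 1) * gauss1 CARD('k) CARD('n))"
proof -
  let ?S = "\<lambda>c. card (rank_ball emb x 1 \<inter> rank_ball emb c (CARD('n) - 1))"
  from x have "card {c \<in> C. x \<in> rank_ball emb c (CARD('n) - 1)} = 1"
    by (simp add: barely_covered_def cover_count_def)
  then obtain c0 where c0: "{c \<in> C. x \<in> rank_ball emb c (CARD('n) - 1)} = {c0}"
    by (rule card_1_singletonE)
  then have c0C: "c0 \<in> C" and "rank_weight emb (x - c0) \<le> CARD('n) - 1"
    by (auto simp: rank_ball_eq)
  moreover have "\<not> rank_weight emb (x - c0) \<le> CARD('n) - 2"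
    using x c0C by (auto simp: barely_covered_def rank_ball_eq)
  ultimately have rank_c0: "rank_weight emb (x - c0) = CARD('n) - 1" by linarith
  have rank_c: "rank_weight emb (x - c) = CARD('n)" if "c \<in> C - {c0}" for c
  proof -
    have "\<not> rank_weight emb (x - c) \<le> CARD('n) - 1"
      using that c0 by (auto simp: rank_ball_eq)
    then show ?thesis using rank_weight_le[of "x - c"] by linarith
  qed
  let ?L = "{y. rank_weight emb y \<le> 1 \<and> rank_weight emb (x - c0 + y) \<le> CARD('n) - 1}"
  let ?R = "{y. rank_weight emb y \<le> 1 \<and> rank_weight emb (x - c0 + y) = CARD('n)}"
  have "{y :: 'f ^ 'n. rank_weight emb y \<le> 1} = ?L \<union> ?R"
  proof -
    have "r \<le> CARD('n) - 1 \<or> r = CARD('n)" if "r \<le> CARD('n)" for r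
      using that by linarith
    then show ?thesis using rank_weight_le by blast
  qed
  moreover have "?L \<inter> ?R = {}"
    using n by auto
  ultimately have "rank_ball_volume emb TYPE('n) 1 = card ?L + card ?R"
    by (simp add: rank_ball_volume_eq card_Un_disjoint)
  then have "real (?S c0) = real (rank_ball_volume emb TYPE('n) 1)
      - real CARD('k) ^ (CARD('n) - 1) * (real CARD('f) - real CARD('k) ^ (CARD('n) - 1))"
    using real_card_raising_corank_1[OF rank_c0] by (simp only: card_ball_inter_ball of_nat_add)
  moreover have "real (?S c) = real CARD('k) ^ (CARD('n) - 1) * gauss1 CARD('k) CARD('n)"
    if "c \<in> C - {c0}" for c
    unfolding card_ball_inter_ball by (rule real_card_lowering_full_rank[OF rank_c[OF that]])
  then have "(\<Sum>c\<in>C - {c0}. real (?S c)) =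
      (real (card C) - 1) * (real CARD('k) ^ (CARD('n) - 1) * gauss1 CARD('k) CARD('n))"
    using c0C card_gt_0_iff[of C] by (auto simp: of_nat_diff Suc_le_eq)
  ultimately show ?thesis
    using c0C by (simp add: sum_cover_count sum.remove[of C c0])
qed

text \<open>If a codeword \<open>c\<close> lies at distance exactly \<open>n - 1\<close> from
  \<open>z\<close>, then neither \<open>z\<close> nor its neighbours within \<open>n - 2\<close> of
  \<open>c\<close> are barely covered. Otherwise all codewords covering \<open>z\<close> are within
  \<open>n - 2\<close>, hence also cover every neighbour of \<open>z\<close>, and no neighbour has
  cover count 1.\<close>

lemma card_barely_covered_ball_le:
  fixes C :: "('f ^ 'n) set"
  assumes z: "2 \<le> cover_count C z" and n: "2 \<le> CARD('n)" and Q: "CARD('k) ^ CARD('n) \<le> CARD('f)"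
  shows "real (card (rank_ball emb z 1 \<inter> barely_covered C)) \<le>
    real (rank_ball_volume emb TYPE('n) 1) - 1
      - real CARD('k) ^ (CARD('n) - 2) * gauss1 CARD('k) (CARD('n) - 1)"
proof (cases "\<exists>c\<in>C. rank_weight emb (z - c) = CARD('n) - 1")
  case True
  then obtain c where c: "c \<in> C" "rank_weight emb (z - c) = CARD('n) - 1" by blast
  let ?L = "rank_ball emb z 1 \<inter> rank_ball emb c (CARD('n) - 2)"
  let ?T = "rank_ball emb z 1 \<inter> barely_covered C"
  \<comment> \<open>The centre is counted apart from the neighbours close to \<open>c\<close>; it
    accounts for the 1 subtracted in the bound.\<close>
  have z_notin: "z \<notin> ?L" "z \<notin> ?T"
    using c n z by (auto simp: rank_ball_eq barely_covered_def)
  have disj: "?L \<inter> ?T = {}"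
    using c by (auto simp: barely_covered_def)
  have "insert z (?L \<union> ?T) \<subseteq> rank_ball emb z 1"
    by (auto simp: rank_ball_eq)
  then have "card (insert z (?L \<union> ?T)) \<le> card (rank_ball emb z 1)"
    by (rule card_mono[rotated]) simp
  then have "1 + card ?L + card ?T \<le> rank_ball_volume emb TYPE('n) 1"
    using z_notin disj by (simp add: card_rank_ball card_Un_disjoint)
  then show ?thesis
    using real_card_lowering_corank_1_ge[OF c(2) n] unfolding card_ball_inter_ball[symmetric] by simp
next
  case False
  have "rank_ball emb z 1 \<inter> barely_covered C = {}"
  proof (rule ccontr)
    assume "rank_ball emb z 1 \<inter> barely_covered C \<noteq> {}"
    then obtain y where y: "rank_weight emb (y - z) \<le> 1" "cover_count C y = 1"
      by (auto simp: rank_ball_eq barely_covered_def)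
    have "{c \<in> C. z \<in> rank_ball emb c (CARD('n) - 1)} \<subseteq> {c \<in> C. y \<in> rank_ball emb c (CARD('n) - 1)}"
    proof clarify
      fix c assume c: "c \<in> C" "z \<in> rank_ball emb c (CARD('n) - 1)"
      then have "rank_weight emb (z - c) \<le> CARD('n) - 1" "rank_weight emb (z - c) \<noteq> CARD('n) - 1"
        using False by (auto simp: rank_ball_eq)
      moreover have "rank_weight emb (y - c) \<le> rank_weight emb (y - z) + rank_weight emb (z - c)"
        using rank_weight_add_le[of "y - z" "z - c"] by simp
      ultimately have "rank_weight emb (y - c) \<le> CARD('n) - 1"
        using y(1) by linarith
      then show "y \<in> rank_ball emb c (CARD('n) - 1)"
        by (simp add: rank_ball_eq)
    qed
    then have "cover_count C z \<le> cover_count C y"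
      unfolding cover_count_def by (rule card_mono[rotated]) simp
    then show False using y(2) z by simp
  qed
  then show ?thesis using rank_ball_volume_1_ge[OF Q] by simp
qed

text \<open>A vector that is not barely covered is covered twice or lies within \<open>n - 2\<close>
  of the code. The total excess bounds the former, the volume of the smaller balls the
  latter.\<close>

lemma card_barely_covered_ge:
  fixes C :: "('f ^ 'n) set"
  assumes cover: "\<And>x. 1 \<le> cover_count C x"
  shows "2 * CARD('f) ^ CARD('n) \<le> card (barely_covered C) + card C *
    (rank_ball_volume emb TYPE('n) (CARD('n) - 1) + rank_ball_volume emb TYPE('n) (CARD('n) - 2))"
proof -
  let ?Z = "{x. 2 \<le> cover_count C x}"
  let ?B = "\<Union>c\<in>C. rank_ball emb c (CARD('n) - 2)"
  have "UNIV = barely_covered C \<union> ?Z \<union> ?B"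
  proof -
    have "cover_count C x = 1 \<or> 2 \<le> cover_count C x" for x
      using cover[of x] by linarith
    then show ?thesis by (auto simp: barely_covered_def)
  qed
  then have "CARD('f ^ 'n) \<le> card (barely_covered C) + card ?Z + card ?B"
    by (metis card_Un_le add_le_mono1 order_trans)
  moreover have "card ?B \<le> card C * rank_ball_volume emb TYPE('n) (CARD('n) - 2)"
    using card_UN_le[of C "\<lambda>c. rank_ball emb c (CARD('n) - 2)"] by (simp add: card_rank_ball)
  moreover have "CARD('f ^ 'n) + card ?Z \<le> card C * rank_ball_volume emb TYPE('n) (CARD('n) - 1)"
  proof -
    \<comment> \<open>Each vector is charged 1, or 2 if covered at least twice, which its cover
      count dominates.\<close>
    have "CARD('f ^ 'n) + card ?Z = (\<Sum>x\<in>UNIV. 1 + of_bool (2 \<le> cover_count C x))"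
      unfolding sum.distrib by (simp add: of_bool_def sum.If_cases)
    also have "\<dots> \<le> (\<Sum>x\<in>UNIV. cover_count C x)"
      by (rule sum_mono) (use cover in auto)
    finally show ?thesis by (simp only: sum_UNIV_cover_count)
  qed
  ultimately show ?thesis
    by (simp add: distrib_left)
qed

lemma excess_inequality:
  fixes C :: "('f ^ 'n) set"
  defines "v \<equiv> \<lambda>r. real (rank_ball_volume emb TYPE('n) r)"
  defines "K \<equiv> real (card C)"
  defines "N \<equiv> real CARD('f) ^ CARD('n)"
  defines "\<alpha> \<equiv> real CARD('k) ^ (CARD('n) - 1) * gauss1 CARD('k) CARD('n)"
  defines "\<beta> \<equiv> real CARD('k) ^ (CARD('n) - 1) * (real CARD('f) + gauss1 CARD('k) (CARD('n) - 1))"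
  defines "\<delta> \<equiv> v 1 - 1 - real CARD('k) ^ (CARD('n) - 2) * gauss1 CARD('k) (CARD('n) - 1)"
  assumes cover: "\<And>x. \<exists>c\<in>C. rank_weight emb (x - c) \<le> CARD('n) - 1"
    and n: "2 \<le> CARD('n)" and Q: "CARD('k) ^ CARD('n) \<le> CARD('f)"
  shows "(K * \<alpha> - \<beta>) * (2 * N - K * (v (CARD('n) - 1) + v (CARD('n) - 2))) \<le> \<delta> * (K * v (CARD('n) - 1) - N)"
proof -
  let ?q = "real CARD('k)" and ?Q = "real CARD('f)"
  let ?T = "barely_covered C"
  define e where "e y = real (cover_count C y) - 1" for y
  have q: "1 < ?q" using card_ground_gt_1 by simp
  have cover1: "1 \<le> cover_count C y" for y
  proof -
    have "{c \<in> C. y \<in> rank_ball emb c (CARD('n) - 1)} \<noteq> {}"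
      using cover[of y] by (auto simp: rank_ball_eq)
    then show ?thesis
      unfolding cover_count_def by (simp add: Suc_le_eq card_gt_0_iff)
  qed
  have e_nonneg: "0 \<le> e y" for y
    using cover1[of y] by (simp add: e_def)
  have sum_e: "(\<Sum>y\<in>UNIV. e y) = K * v (CARD('n) - 1) - N"
  proof -
    have "(\<Sum>y\<in>UNIV. e y) = real (\<Sum>y\<in>UNIV. cover_count C y) - real CARD('f ^ 'n)"
      by (simp add: e_def sum_subtractf)
    then show ?thesis
      by (simp only: sum_UNIV_cover_count of_nat_mult CARD_vec of_nat_power K_def v_def N_def)
  qed
  \<comment> \<open>This recursion merges \<alpha> with the count of rank-raising perturbations into
    \<beta>.\<close>
  have gauss: "gauss1 CARD('k) CARD('n) = ?q ^ (CARD('n) - 1) + gauss1 CARD('k) (CARD('n) - 1)"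
  proof -
    have "?q ^ CARD('n) = ?q * ?q ^ (CARD('n) - 1)"
      by (simp flip: power_Suc)
    then show ?thesis using q by (simp add: gauss1_def field_simps)
  qed
  have excess: "(\<Sum>y\<in>rank_ball emb x 1. e y) = K * \<alpha> - \<beta>" if "x \<in> ?T" for x
  proof -
    have "(\<Sum>y\<in>rank_ball emb x 1. e y) = real (\<Sum>y\<in>rank_ball emb x 1. cover_count C y) - v 1"
      by (simp add: e_def sum_subtractf card_rank_ball v_def)
    also have "\<dots> = (K - 1) * \<alpha> - ?q ^ (CARD('n) - 1) * (?Q - ?q ^ (CARD('n) - 1))"
      unfolding sum_cover_count_ball[OF that n] by (simp add: v_def \<alpha>_def K_def)
    also have "\<dots> = K * \<alpha> - \<beta>"
      unfolding \<alpha>_def \<beta>_def gauss by (simp add: algebra_simps)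
    finally show ?thesis .
  qed
  have "real (card ?T) * (K * \<alpha> - \<beta>) = (\<Sum>x\<in>?T. \<Sum>y\<in>rank_ball emb x 1. e y)"
    using excess by (simp del: One_nat_def)
  also have "\<dots> = (\<Sum>x\<in>?T. \<Sum>y | y \<in> UNIV \<and> y \<in> rank_ball emb x 1. e y)"
    by simp
  also have "\<dots> = (\<Sum>y\<in>UNIV. \<Sum>x | x \<in> ?T \<and> y \<in> rank_ball emb x 1. e y)"
    by (rule sum.swap_restrict) auto
  also have "\<dots> \<le> (\<Sum>y\<in>UNIV. \<delta> * e y)"
  proof (rule sum_mono)
    fix y :: "'f ^ 'n"
    have sym: "y \<in> rank_ball emb x 1 \<longleftrightarrow> x \<in> rank_ball emb y 1" for x
      using rank_weight_uminus[of "x - y"] by (simp add: rank_ball_eq)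
    have "{x \<in> ?T. y \<in> rank_ball emb x 1} = rank_ball emb y 1 \<inter> ?T"
      unfolding sym by blast
    then have eq: "(\<Sum>x | x \<in> ?T \<and> y \<in> rank_ball emb x 1. e y) = real (card (rank_ball emb y 1 \<inter> ?T)) * e y"
      by simp
    \<comment> \<open>Vectors of excess 0 contribute nothing, so the bound \<delta> on barely
      covered neighbours is needed only where the cover count is at least 2.\<close>
    show "(\<Sum>x | x \<in> ?T \<and> y \<in> rank_ball emb x 1. e y) \<le> \<delta> * e y"
    proof (cases "2 \<le> cover_count C y")
      case True
      then show ?thesis
        unfolding eq \<delta>_def v_def
        by (intro mult_right_mono card_barely_covered_ball_le n Q e_nonneg)
    next
      case False
      then have "e y = 0" using cover1[of y] by (simp add: e_def)
      then show ?thesis unfolding eq by simp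
    qed
  qed
  also have "\<dots> = \<delta> * (K * v (CARD('n) - 1) - N)"
    by (simp only: sum_distrib_left[symmetric] sum_e)
  finally have upper: "real (card ?T) * (K * \<alpha> - \<beta>) \<le> \<delta> * (K * v (CARD('n) - 1) - N)" .
  have "real (2 * CARD('f) ^ CARD('n)) \<le> real (card ?T + card C *
      (rank_ball_volume emb TYPE('n) (CARD('n) - 1) + rank_ball_volume emb TYPE('n) (CARD('n) - 2)))"
    using card_barely_covered_ge[OF cover1] by (simp only: of_nat_le_iff)
  then have lower: "2 * N - K * (v (CARD('n) - 1) + v (CARD('n) - 2)) \<le> real (card ?T)"
    by (simp add: N_def K_def v_def algebra_simps)
  \<comment> \<open>The sign is needed to multiply \<open>lower\<close> by this factor. It is a sum
    of excesses if \<open>?T\<close> is nonempty; otherwise \<open>lower\<close> forces the code to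
    be large.\<close>
  have "0 \<le> K * \<alpha> - \<beta>"
  proof (cases "?T = {}")
    case False
    then obtain x where "x \<in> ?T" by blast
    then show ?thesis using excess[of x] sum_nonneg[of _ e] e_nonneg by metis
  next
    case True
    let ?G = "gauss1 CARD('k) CARD('n)"
    have "real ((CARD('k) - 1) * (rank_ball_volume emb TYPE('n) (CARD('n) - 1)
        + rank_ball_volume emb TYPE('n) (CARD('n) - 2))) \<le>
        real ((CARD('k) ^ CARD('n) - 1) * CARD('f) ^ (CARD('n) - 1))"
      using card_rank_deficient_le[OF n] by (simp only: of_nat_le_iff rank_ball_volume_eq)
    then have "(?q - 1) * (v (CARD('n) - 1) + v (CARD('n) - 2)) \<le> (?q ^ CARD('n) - 1) * ?Q ^ (CARD('n) - 1)"
      using q by (simp add: v_def of_nat_diff)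
    then have V: "v (CARD('n) - 1) + v (CARD('n) - 2) \<le> ?G * ?Q ^ (CARD('n) - 1)"
      using q by (simp add: gauss1_def field_simps)
    have "2 * N \<le> K * (v (CARD('n) - 1) + v (CARD('n) - 2))"
      using lower True by simp
    also have "\<dots> \<le> K * (?G * ?Q ^ (CARD('n) - 1))"
      by (rule mult_left_mono[OF V]) (simp add: K_def)
    finally have "2 * ?Q * ?Q ^ (CARD('n) - 1) \<le> (K * ?G) * ?Q ^ (CARD('n) - 1)"
      by (simp add: N_def mult.assoc flip: power_Suc)
    then have QK: "2 * ?Q \<le> K * ?G"
      by (rule mult_right_le_imp_le) simp
    \<comment> \<open>With \<open>Q\<close> this bounds \<beta> by \<open>2 * ?Q\<close> times
      \<open>?q ^ (CARD('n) - 1)\<close>, which is the form in which \<open>QK\<close> can be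
      applied.\<close>
    have "gauss1 CARD('k) (CARD('n) - 1) \<le> ?q ^ CARD('n)"
    proof -
      have "0 \<le> ?G - gauss1 CARD('k) (CARD('n) - 1)"
        unfolding gauss by simp
      moreover have "?G \<le> (?q ^ CARD('n) - 1) / 1"
        unfolding gauss1_def
      proof (rule divide_left_mono)
        show "1 \<le> ?q - 1" using card_ground_gt_1 by simp
        show "0 \<le> ?q ^ CARD('n) - 1" using q by (simp add: one_le_power)
        show "0 < (?q - 1) * 1" using q by simp
      qed
      ultimately show ?thesis by simp
    qed
    also have "\<dots> \<le> ?Q"
      using Q by (simp flip: of_nat_power)
    finally have "\<beta> \<le> ?q ^ (CARD('n) - 1) * (2 * ?Q)"
      unfolding \<beta>_def by (intro mult_left_mono) auto
    also have "\<dots> \<le> ?q ^ (CARD('n) - 1) * (K * ?G)"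
      by (rule mult_left_mono[OF QK]) simp
    also have "\<dots> = K * \<alpha>" by (simp add: \<alpha>_def)
    finally show ?thesis by simp
  qed
  then have "(K * \<alpha> - \<beta>) * (2 * N - K * (v (CARD('n) - 1) + v (CARD('n) - 2))) \<le> (K * \<alpha> - \<beta>) * real (card ?T)"
    by (rule mult_left_mono[OF lower])
  also have "\<dots> \<le> \<delta> * (K * v (CARD('n) - 1) - N)"
    using upper by (simp add: mult.commute)
  finally show ?thesis .
qed

end

section \<open>The quadratic inequality for an optimal code\<close>

theorem corollary5:
  fixes emb :: "'k::{field,finite} \<Rightarrow> 'f::{field,finite}"
    and q m n :: nat
  assumes "finite_field_extension emb"
    and "CARD('k) = q"
    and "CARD('f) = q ^ m"
    and "CARD('n::finite) = n"
    and "2 \<le> n"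
    and "n \<le> m"
  shows
    "let v = (\<lambda>r. real (rank_ball_volume emb TYPE('n) r));
         K = real (min_rank_covering_size emb TYPE('n) (n - 1));
         \<alpha> = real q ^ (n - 1) * gauss1 q n;
         \<beta> = real q ^ (n - 1) * (real q ^ m + gauss1 q (n - 1));
         a = \<alpha> * (v (n - 1) + v (n - 2));
         b = v (n - 1) * (real q ^ (n - 2) * gauss1 q (n - 1) - v 1 + \<beta> + 1)
             + 2 * \<alpha> * real q ^ (m * n) + \<beta> * v (n - 2);
         c = real q ^ (m * n) * (2 * \<beta> + 1 + real q ^ (n - 2) * gauss1 q (n - 1) - v 1)
     in a * K\<^sup>2 - b * K + c \<ge> 0"
proof -
  interpret finite_field_extension emb by fact
  obtain C :: "('f ^ 'n) set" where C: "card C = min_rank_covering_size emb TYPE('n) (n - 1)"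
    and cover: "\<And>x. \<exists>c\<in>C. rank_weight emb (x - c) \<le> n - 1"
    using min_rank_covering_sizeE by blast
  \<comment> \<open>This is where \<open>n \<le> m\<close> enters, as the size condition of
    \<open>excess_inequality\<close>.\<close>
  have "q ^ n \<le> q ^ m"
    using card_ground_gt_1 assms by (intro power_increasing) auto
  then have ineq: "(real (card C) * (real q ^ (n - 1) * gauss1 q n)
        - real q ^ (n - 1) * (real (q ^ m) + gauss1 q (n - 1)))
      * (2 * real (q ^ m) ^ n - real (card C) * (real (rank_ball_volume emb TYPE('n) (n - 1))
        + real (rank_ball_volume emb TYPE('n) (n - 2))))
    \<le> (real (rank_ball_volume emb TYPE('n) 1) - 1 - real q ^ (n - 2) * gauss1 q (n - 1))
      * (real (card C) * real (rank_ball_volume emb TYPE('n) (n - 1)) - real (q ^ m) ^ n)"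
    using excess_inequality[of C, unfolded assms(2-4)] cover assms(5) by blast
  have "real (q ^ m) = real q ^ m" "real (q ^ m) ^ n = real q ^ (m * n)"
    by (simp_all add: power_mult)
  \<comment> \<open>Moving everything to one side and collecting powers of the code size yields the
    coefficients \<open>a\<close>, \<open>- b\<close> and \<open>c\<close>.\<close>
  with ineq show ?thesis
    unfolding Let_def C by (simp only:) (simp add: power2_eq_square algebra_simps)
qed

end
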